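(* (1) Let $\mu$ be a probability measure on $\mathbb{R}$ such that $$\alpha:=\int_{\mathbb{R}} e^{\varepsilon x^2}\,d\mu(x)<\infty$$ for some $\varepsilon>0$. Then the distribution $\mu * N(0,t)$ is unimodal for all $t\ge \frac{36\log(2\alpha)}{\varepsilon}$. (2) There exists a probability measure $\mu$ on $\mathbb{R}$ satisfying $$\int_{\mathbb{R}} e^{A|x|^p}\,d\mu(x)<\infty\quad\text{for all } A>0 \text{ and } 0<p<2,$$ and $$\int_{\mathbb{R}} e^{Ax^2}\,d\mu(x)=\infty\quad\text{for all } A>0,$$ such that $\mu * N(0,t)$ is not unimodal for any $t>0$.
   Context: A Borel measure $\mu$ on $\mathbb{R}$ is unimodal if there exist $a\in\mathbb{R}$ and a function $f\colon\mathbb{R}\to[0,\infty)$, non-decreasing on $(-\infty,a)$ and non-increasing on $(a,\infty)$, such that $\mu(dx)=\mu(\{a\})\delta_a+f(x)\,dx$. Here $*$ is the classical convolution of probability measures on $\mathbb{R}$ and $N(0,t)$ is the normal distribution with mean $0$ and variance $t$. *)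

theory Defs
  imports "HOL-Probability.Probability"
begin

(* No measurability assumption on f is needed: a function that is monotone on each of the
   two half-lines is Borel, so the density below is the genuine measure f(x) dx. *)
definition unimodal :: "real measure \<Rightarrow> bool" where
  "unimodal M \<longleftrightarrow> sets M = sets borel \<and>
     (\<exists>a::real. \<exists>f::real \<Rightarrow> real.
        (\<forall>x. 0 \<le> f x) \<and> mono_on {..<a} f \<and> antimono_on {a<..} f \<and>
        (\<forall>B\<in>sets borel. emeasure M B =
           emeasure M {a} * emeasure (return borel a) B +
           emeasure (density lborel (\<lambda>x. ennreal (f x))) B))"

(* Parametrised by the variance t > 0, whereas normal_density takes the standard deviation. *)
definition centered_normal :: "real \<Rightarrow> real measure" where
  "centered_normal t = density lborel (\<lambda>x. ennreal (normal_density 0 (sqrt t) x))"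

end

theory Submission
  imports Defs "HOL-Real_Asymp.Real_Asymp"
begin

text \<open>
  The density of \<open>\<mu> \<star> N(0,t)\<close> is a positive multiple of \<open>g x = \<integral> exp (-(x-y)\<^sup>2/(2t)) d\<mu>(y)\<close>.

  (1) Put \<open>R\<^sup>2 = ln (2\<alpha>)/\<epsilon>\<close>, so that \<open>\<mu>\<close> has mass at least \<open>1/2\<close> on \<open>[-R,R]\<close> and \<open>t \<ge> 36R\<^sup>2\<close>.
  Then \<open>g' \<ge> 0\<close> left of \<open>-2R\<close>, \<open>g' \<le> 0\<close> right of \<open>2R\<close>, and \<open>g'' \<le> 0\<close> in between, so \<open>g'\<close> changes
  sign once. Each sign is obtained by bounding the integrand below by a function of the form
  \<open>a - b exp (\<epsilon>y\<^sup>2)\<close>, whose integral \<open>a - b\<alpha>\<close> is explicit.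

  (2) Take atoms at \<open>4\<^sup>n\<close> with weights proportional to \<open>exp (-16\<^sup>n/n)\<close>. For every \<open>t\<close> and all large
  \<open>n\<close> these weights exceed \<open>exp (-16\<^sup>n/(32t))\<close>, which bounds the contribution to \<open>g\<close> near \<open>4\<^sup>n/2\<close> of
  the atoms up to \<open>4\<^sup>n\<close>, while the atoms beyond \<open>4\<^sup>n\<close> contribute more near \<open>4\<^sup>n\<close> than near \<open>4\<^sup>n/2\<close>.
  Hence \<open>g\<close> is larger near \<open>4\<^sup>n\<close> than near \<open>4\<^sup>n/2\<close>, for arbitrarily large \<open>n\<close>.
\<close>

section \<open>Convolution with a normal distribution\<close>

text \<open>Only one factor has a density; the other may be singular, as the atomic measure of the
  second statement is. Substituting x = y + u turns the inner integral into one over a translate of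
  \<open>f\<close>, and Tonelli exchanges the order of integration.\<close>

lemma convolution_density_lborel:
  fixes f :: "real \<Rightarrow> ennreal"
  assumes "finite_measure M" and sets_M: "sets M = sets borel"
    and f [measurable]: "f \<in> borel_measurable borel"
    and fin: "finite_measure (density lborel f)"
  shows "M \<star> density lborel f = density lborel (\<lambda>x. \<integral>\<^sup>+y. f (x - y) \<partial>M)"
proof (rule measure_eqI)
  note [measurable_cong] = sets_M
  interpret M: finite_measure M by fact
  interpret pair_sigma_finite M lborel ..
  fix A :: "real set" assume "A \<in> sets (M \<star> density lborel f)"
  then have [measurable]: "A \<in> sets borel" by simp
  have "emeasure (M \<star> density lborel f) A
      = (\<integral>\<^sup>+y. \<integral>\<^sup>+u. indicator A (y + u) \<partial>density lborel f \<partial>M)"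
    by (rule convolution_emeasure') (auto simp: assms)
  also have "\<dots> = (\<integral>\<^sup>+y. \<integral>\<^sup>+u. f u * indicator A (y + u) \<partial>lborel \<partial>M)"
    by (intro nn_integral_cong) (simp add: nn_integral_density)
  also have "\<dots> = (\<integral>\<^sup>+y. \<integral>\<^sup>+x. f (x - y) * indicator A x \<partial>lborel \<partial>M)"
  proof (rule nn_integral_cong)
    fix y :: real
    show "(\<integral>\<^sup>+u. f u * indicator A (y + u) \<partial>lborel) = (\<integral>\<^sup>+x. f (x - y) * indicator A x \<partial>lborel)"
      by (subst nn_integral_real_affine[of _ 1 y]) (auto simp: algebra_simps)
  qed
  also have "\<dots> = (\<integral>\<^sup>+x. \<integral>\<^sup>+y. f (x - y) * indicator A x \<partial>M \<partial>lborel)"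
    by (rule Fubini'[symmetric]) measurable
  also have "\<dots> = (\<integral>\<^sup>+x. (\<integral>\<^sup>+y. f (x - y) \<partial>M) * indicator A x \<partial>lborel)"
    by (intro nn_integral_cong nn_integral_multc) measurable
  also have "\<dots> = emeasure (density lborel (\<lambda>x. \<integral>\<^sup>+y. f (x - y) \<partial>M)) A"
    by (subst emeasure_density) auto
  finally show "emeasure (M \<star> density lborel f) A
      = emeasure (density lborel (\<lambda>x. \<integral>\<^sup>+y. f (x - y) \<partial>M)) A" .
qed simp

lemma normal_density_0_sqrt:
  "0 < t \<Longrightarrow> normal_density 0 (sqrt t) u = exp (- u\<^sup>2 / (2 * t)) / sqrt (2 * pi * t)"
  by (simp add: normal_density_def)

lemma (in real_distribution) integrable_exp_neg_square:
  "0 < t \<Longrightarrow> integrable M (\<lambda>y. exp (- (x - y)\<^sup>2 / (2 * t)))"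
  by (rule integrable_const_bound[of _ 1]) auto

lemma (in real_distribution) convolution_centered_normal:
  assumes "0 < t"
  shows "M \<star> centered_normal t = density lborel
    (\<lambda>x. ennreal ((LINT y|M. exp (- (x - y)\<^sup>2 / (2 * t))) / sqrt (2 * pi * t)))"
proof -
  have "sqrt t > 0" using assms by simp
  have "M \<star> centered_normal t
      = density lborel (\<lambda>x. \<integral>\<^sup>+y. ennreal (normal_density 0 (sqrt t) (x - y)) \<partial>M)"
    unfolding centered_normal_def
    using prob_space_normal_density[OF \<open>sqrt t > 0\<close>]
    by (intro convolution_density_lborel)
      (auto intro: finite_measure_axioms prob_space.finite_measure)
  also have "\<dots> = density lborel
      (\<lambda>x. ennreal ((LINT y|M. exp (- (x - y)\<^sup>2 / (2 * t))) / sqrt (2 * pi * t)))"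
    using assms integrable_exp_neg_square[OF assms]
    by (intro arg_cong[where f = "density lborel"] ext)
      (subst nn_integral_eq_integral, auto simp: normal_density_0_sqrt)
  finally show ?thesis .
qed

text \<open>Dominated convergence along sequences: the mean value inequality bounds every difference
  quotient by \<open>C\<close>, a constant integrable over the finite measure \<open>M\<close>. The
  bound \<open>D\<close> makes each F(z - y) integrable, so that the quotient can be taken outside
  the integral.\<close>

lemma has_field_derivative_integral_translate:
  fixes F F' :: "real \<Rightarrow> real"
  assumes "finite_measure M" and sets_M: "sets M = sets borel"
    and F: "\<And>u. (F has_field_derivative F' u) (at u)"
    and F': "F' \<in> borel_measurable borel"
    and bound: "\<And>u. \<bar>F u\<bar> \<le> D" "\<And>u. \<bar>F' u\<bar> \<le> C"
  shows "((\<lambda>x. LINT y|M. F (x - y)) has_field_derivative (LINT y|M. F' (x - y))) (at x)"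
  unfolding has_field_derivative_iff tendsto_at_iff_sequentially o_def
proof (intro allI impI)
  note [measurable_cong] = sets_M
  note [measurable] = F'
  interpret finite_measure M by fact
  have [measurable]: "F \<in> borel_measurable borel"
    by (intro borel_measurable_continuous_onI continuous_at_imp_continuous_on ballI)
      (rule DERIV_isCont[OF F])
  have int: "integrable M (\<lambda>y. F (z - y))" for z
    by (rule integrable_const_bound[of _ D]) (auto simp: bound)
  have lip: "\<bar>F b - F a\<bar> \<le> C * \<bar>b - a\<bar>" for a b
    using field_differentiable_bound[of UNIV F F' C b a] F bound by auto
  fix X :: "nat \<Rightarrow> real" assume X: "\<forall>i. X i \<in> UNIV - {x}" "X \<longlonglongrightarrow> x"
  have "(\<lambda>i. LINT y|M. (F (X i - y) - F (x - y)) / (X i - x)) \<longlonglongrightarrow> (LINT y|M. F' (x - y))"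
  proof (rule integral_dominated_convergence[where w = "\<lambda>_. C"])
    have "(\<lambda>i. (F (X i - y) - F (x - y)) / (X i - x)) \<longlonglongrightarrow> F' (x - y)" for y
    proof -
      have "((\<lambda>z. z - y) has_field_derivative 1) (at x)"
        by (auto intro!: derivative_eq_intros)
      from DERIV_chain2[OF F this]
      have "((\<lambda>z. F (z - y)) has_field_derivative F' (x - y)) (at x)" by simp
      then show ?thesis
        using X unfolding has_field_derivative_iff tendsto_at_iff_sequentially o_def by blast
    qed
    then show "AE y in M. (\<lambda>i. (F (X i - y) - F (x - y)) / (X i - x)) \<longlonglongrightarrow> F' (x - y)"
      by simp
    have "\<bar>F (X i - y) - F (x - y)\<bar> / \<bar>X i - x\<bar> \<le> C" for i y
      using lip[of "X i - y" "x - y"] X(1) by (simp add: divide_le_eq)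
    then show "AE y in M. norm ((F (X i - y) - F (x - y)) / (X i - x)) \<le> C" for i
      by simp
  qed auto
  moreover have "(LINT y|M. (F (X i - y) - F (x - y)) / (X i - x))
      = ((LINT y|M. F (X i - y)) - (LINT y|M. F (x - y))) / (X i - x)" for i
    using int by simp
  ultimately show "(\<lambda>i. ((LINT y|M. F (X i - y)) - (LINT y|M. F (x - y))) / (X i - x))
      \<longlonglongrightarrow> (LINT y|M. F' (x - y))" by (simp only:)
qed

section \<open>Unimodality under a Gaussian moment\<close>

text \<open>The intermediate value theorem gives a zero \<open>a\<close> of g' in [-b,b]. Since g'
  is non-increasing there, it is nonnegative on [-b,a] and nonpositive on [a,b]; the outer sign
  conditions extend this to the two half-lines.\<close>

lemma mono_antimono_on_if_deriv:
  fixes g g' g'' :: "real \<Rightarrow> real"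
  assumes g: "\<And>x. (g has_field_derivative g' x) (at x)"
    and g': "\<And>x. (g' has_field_derivative g'' x) (at x)"
    and left: "\<And>x. x \<le> - b \<Longrightarrow> 0 \<le> g' x" and right: "\<And>x. b \<le> x \<Longrightarrow> g' x \<le> 0"
    and mid: "\<And>x. \<bar>x\<bar> \<le> b \<Longrightarrow> g'' x \<le> 0" and "0 \<le> b"
  obtains a where "mono_on {..<a} g" "antimono_on {a<..} g"
proof -
  have "\<exists>a\<ge>- b. a \<le> b \<and> g' a = 0"
    using left[of "-b"] right[of b] \<open>0 \<le> b\<close> DERIV_isCont[OF g']
    by (intro IVT2) auto
  then obtain a where a: "- b \<le> a" "a \<le> b" "g' a = 0" by blast
  have anti: "g' y \<le> g' x" if "- b \<le> x" "x \<le> y" "y \<le> b" for x y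
  proof (rule DERIV_nonpos_imp_nonincreasing[where f = g'])
    fix z assume "x \<le> z" "z \<le> y"
    then have "g'' z \<le> 0" using that by (intro mid) auto
    then show "\<exists>d. (g' has_field_derivative d) (at z) \<and> d \<le> 0" using g' by blast
  qed fact
  have "0 \<le> g' x" if "x \<le> a" for x
    using anti[of x a] left[of x] a that by fastforce
  then have pos: "\<exists>d. (g has_field_derivative d) (at x) \<and> 0 \<le> d" if "x \<le> a" for x
    using g that by blast
  have "mono_on {..<a} g"
    by (rule monotone_onI, rule DERIV_nonneg_imp_nondecreasing[where f = g]) (simp_all add: pos)
  moreover
  have "g' x \<le> 0" if "a \<le> x" for x
    using anti[of a x] right[of x] a that by fastforce
  then have neg: "\<exists>d. (g has_field_derivative d) (at x) \<and> d \<le> 0" if "a \<le> x" for x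
    using g that by blast
  have "antimono_on {a<..} g"
    by (rule monotone_onI, rule DERIV_nonpos_imp_nonincreasing[where f = g]) (simp_all add: neg)
  ultimately show thesis by (rule that)
qed

lemma unimodal_densityI:
  assumes [measurable]: "f \<in> borel_measurable borel" and "\<And>x. 0 \<le> f x"
    and "mono_on {..<a} f" "antimono_on {a<..} f"
  shows "unimodal (density lborel (\<lambda>x. ennreal (f x)))"
proof -
  \<comment> \<open>There is no atom at \<open>a\<close>, so the Dirac term in
    \<open>unimodal\<close> vanishes and \<open>f\<close> itself is the required density.\<close>
  have "emeasure (density lborel (\<lambda>x. ennreal (f x))) {a} = 0"
    by (simp add: emeasure_density nn_integral_null_set finite_imp_null_set_lborel)
  then show ?thesis
    unfolding unimodal_def using assms by (intro conjI exI[of _ a] exI[of _ f]) auto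
qed


section \<open>Derivatives of the Gaussian kernel and their bounds\<close>

text \<open>With v = u^2/t this controls the second derivative of the kernel. It follows from |1-v|
  <= max 1 v together with v <= (1+v/4)^2 <= exp(v/2).\<close>

lemma abs_one_minus_mult_exp_le:
  fixes v :: real
  assumes "0 \<le> v"
  shows "\<bar>(1 - v) * exp (- v / 2)\<bar> \<le> 1"
proof -
  have "v \<le> (1 + v / 4)\<^sup>2"
    using zero_le_power2[of "1 - v / 4"] by (simp add: power2_eq_square algebra_simps)
  also have "\<dots> \<le> (exp (v / 4))\<^sup>2"
    using assms by (intro power_mono exp_ge_add_one_self) auto
  also have "\<dots> = exp (v / 2)"
    by (simp flip: exp_double)
  finally have "\<bar>1 - v\<bar> \<le> exp (v / 2)"
    using assms by (auto simp: abs_if intro: order_trans[of _ 1])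
  then show ?thesis
    by (simp add: abs_mult exp_minus field_simps)
qed

lemma gaussian_deriv1:
  "0 < t \<Longrightarrow> ((\<lambda>u::real. exp (- u\<^sup>2 / (2 * t))) has_field_derivative - (u / t * exp (- u\<^sup>2 / (2 * t)))) (at u)"
  by (auto intro!: derivative_eq_intros simp: field_simps)

lemma gaussian_deriv2:
  fixes t u :: real
  assumes "0 < t"
  shows "((\<lambda>u. - (u / t * exp (- u\<^sup>2 / (2 * t)))) has_field_derivative
    - ((1 - u\<^sup>2 / t) * exp (- u\<^sup>2 / (2 * t)) / t)) (at u)"
  using assms by (auto intro!: derivative_eq_intros simp: field_simps power2_eq_square)

text \<open>The constant is not sharp; a finite bound is what integrability and dominated
  convergence ask for. It comes from 2|u| <= 1+u^2 and 1+z <= exp z.\<close>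

lemma gaussian_deriv1_bound:
  fixes t u :: real
  assumes "0 < t"
  shows "\<bar>- (u / t * exp (- u\<^sup>2 / (2 * t)))\<bar> \<le> (1 + t) / t"
proof -
  have "2 * \<bar>u\<bar> \<le> 1 + u\<^sup>2"
    using zero_le_power2[of "\<bar>u\<bar> - 1"] by (simp add: power2_diff)
  moreover have "0 \<le> u\<^sup>2 / (2 * t)" using assms by simp
  moreover have "(1 + t) * (1 + u\<^sup>2 / (2 * t)) = 1 + u\<^sup>2 / (2 * t) + t + u\<^sup>2 / 2"
    using assms by (simp add: field_simps)
  ultimately have "\<bar>u\<bar> \<le> (1 + t) * (1 + u\<^sup>2 / (2 * t))"
    using assms by linarith
  also have "\<dots> \<le> (1 + t) * exp (u\<^sup>2 / (2 * t))"
    using assms by (intro mult_left_mono exp_ge_add_one_self) auto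
  finally show ?thesis
    using assms by (simp add: abs_mult exp_minus field_simps)
qed

lemma gaussian_deriv2_bound:
  fixes t u :: real
  assumes "0 < t"
  shows "\<bar>- ((1 - u\<^sup>2 / t) * exp (- u\<^sup>2 / (2 * t)) / t)\<bar> \<le> 1 / t"
  using abs_one_minus_mult_exp_le[of "u\<^sup>2 / t"] assms
  by (simp add: divide_right_mono mult.commute)

section \<open>Pointwise minorants with explicit integrals\<close>

text \<open>The right side is, up to a negative factor, the integrand of g'. The factor 1 -
  exp(e(y^2-R^2)) is at most 1 and is nonpositive for |y| >= R, so a positive contribution is
  claimed only on [-R,R], where x-y >= x-R and |x-y| <= x+R. The last term pays for y > x, where the
  right side is negative.\<close>

lemma exp_minorant_outer:
  fixes R x t e y :: real
  assumes "0 < R" "R \<le> x" "0 < e" "0 < t"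
  shows "(x - R) * exp (- (x + R)\<^sup>2 / (2 * t)) * (1 - exp (e * (y\<^sup>2 - R\<^sup>2)))
      - exp (e * (y\<^sup>2 - x\<^sup>2)) / (2 * e * x)
    \<le> (x - y) * exp (- (x - y)\<^sup>2 / (2 * t))" (is "?A * (1 - ?B) - ?C \<le> ?D")
proof -
  have nn: "0 \<le> ?A" "0 \<le> ?C" "0 < ?B" using assms by auto
  consider "\<bar>y\<bar> \<le> R" | "\<bar>y\<bar> > R" "y \<le> x" | "\<bar>y\<bar> > R" "y > x" by linarith
  then show ?thesis
  proof cases
    case 1
    have "(x - y)\<^sup>2 \<le> (x + R)\<^sup>2" using 1 assms by (intro power_mono) auto
    then have "exp (- (x + R)\<^sup>2 / (2 * t)) \<le> exp (- (x - y)\<^sup>2 / (2 * t))"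
      using assms by (simp add: divide_right_mono)
    then have "?A \<le> ?D" using 1 assms by (intro mult_mono) auto
    moreover have "?A * (1 - ?B) \<le> ?A" using nn by (intro mult_left_le) auto
    ultimately show ?thesis using nn by linarith
  next
    case 2
    then have "1 \<le> ?B" using assms by (simp add: abs_le_square_iff[symmetric])
    then have "?A * (1 - ?B) \<le> 0" using nn by (simp add: mult_nonneg_nonpos)
    moreover have "0 \<le> ?D" using 2 by simp
    ultimately show ?thesis using nn by linarith
  next
    case 3
    then have "1 \<le> ?B" using assms by (simp add: abs_le_square_iff[symmetric])
    then have "?A * (1 - ?B) \<le> 0" using nn by (simp add: mult_nonneg_nonpos)
    moreover have "(y - x) * exp (- (x - y)\<^sup>2 / (2 * t)) \<le> ?C"
    proof -
      \<comment> \<open>The tangent to y^2 at x gives 2x(y-x) <= y^2-x^2; then z <= exp z brings in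
        the exponential moment.\<close>
      have "(y - x) * (2 * e * x) \<le> e * (y\<^sup>2 - x\<^sup>2)"
      proof -
        have "e * (y\<^sup>2 - x\<^sup>2) - (y - x) * (2 * e * x) = e * (y - x)\<^sup>2"
          by (simp add: power2_eq_square algebra_simps)
        then show ?thesis using assms by (smt (verit) mult_nonneg_nonneg zero_le_power2)
      qed
      also have "\<dots> \<le> exp (e * (y\<^sup>2 - x\<^sup>2))"
        using exp_ge_add_one_self[of "e * (y\<^sup>2 - x\<^sup>2)"] by linarith
      finally have "y - x \<le> ?C" using assms by (simp add: field_simps)
      moreover have "(y - x) * exp (- (x - y)\<^sup>2 / (2 * t)) \<le> y - x"
        using 3 assms by (intro mult_left_le) auto
      ultimately show ?thesis by linarith
    qed
    ultimately show ?thesis by (simp add: algebra_simps)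
  qed
qed

text \<open>The right side is, up to a negative factor, the integrand of g''. For |y| <= R it is at
  least 3/4 * 7/8 > 1/2. For R < |y| <= 4R it is nonnegative, and the second term cancels the 1/2.
  Beyond 4R it is at least -1, which the third term covers.\<close>

lemma exp_minorant_inner:
  fixes R x t e y :: real
  assumes "0 < R" "\<bar>x\<bar> \<le> 2 * R" "0 < e" "36 * R\<^sup>2 \<le> t"
  shows "1 / 2 - exp (e * (y\<^sup>2 - R\<^sup>2)) / 2 - exp (e * (y\<^sup>2 - 16 * R\<^sup>2))
    \<le> (1 - (x - y)\<^sup>2 / t) * exp (- (x - y)\<^sup>2 / (2 * t))" (is "1 / 2 - ?B / 2 - ?C \<le> ?D")
proof -
  have "0 < R\<^sup>2" using assms by simp
  then have t: "0 < t" using assms(4) by linarith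
  have nn: "0 < ?B" "0 < ?C" by auto
  consider "\<bar>y\<bar> \<le> R" | "\<bar>y\<bar> > R" "\<bar>y\<bar> \<le> 4 * R" | "\<bar>y\<bar> > R" "\<bar>y\<bar> > 4 * R" by linarith
  then show ?thesis
  proof cases
    case 1
    have "(x - y)\<^sup>2 \<le> (3 * R)\<^sup>2"
      using 1 assms by (subst abs_le_square_iff[symmetric]) auto
    then have "(x - y)\<^sup>2 \<le> t / 4" using assms by (simp add: power_mult_distrib)
    then have v: "(x - y)\<^sup>2 / t \<le> 1 / 4" using t by (simp add: field_simps)
    then have "7 / 8 \<le> 1 + - (x - y)\<^sup>2 / (2 * t)" by (simp add: field_simps)
    also have "\<dots> \<le> exp (- (x - y)\<^sup>2 / (2 * t))" by (rule exp_ge_add_one_self)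
    finally have "3 / 4 * (7 / 8) \<le> ?D" using v by (intro mult_mono) linarith+
    then show ?thesis using nn by linarith
  next
    case 2
    \<comment> \<open>Here 36 = (2+4)^2 enters: |x| <= 2R and |y| <= 4R keep |x-y| within 6R <= sqrt
      t, the range where the Gaussian is concave.\<close>
    have "(x - y)\<^sup>2 \<le> (6 * R)\<^sup>2"
      using 2 assms by (subst abs_le_square_iff[symmetric]) auto
    then have "(x - y)\<^sup>2 / t \<le> 1" using assms t by (simp add: power_mult_distrib)
    then have "0 \<le> ?D" by simp
    moreover have "1 \<le> ?B" using 2 assms by (simp add: abs_le_square_iff[symmetric])
    ultimately show ?thesis using nn by linarith
  next
    case 3
    have "(4 * R)\<^sup>2 \<le> y\<^sup>2"
      using 3 assms by (subst abs_le_square_iff[symmetric]) auto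
    then have "1 \<le> ?C" using assms by (simp add: power_mult_distrib)
    moreover have "1 \<le> ?B" using 3 assms by (simp add: abs_le_square_iff[symmetric])
    moreover have "-1 \<le> ?D"
      using abs_one_minus_mult_exp_le[of "(x - y)\<^sup>2 / t"] t by (simp add: abs_le_iff mult.commute)
    ultimately show ?thesis by linarith
  qed
qed

text \<open>The criterion \<open>mono_antimono_on_if_deriv\<close> is applied with b = 2R. Its three
  sign conditions follow by integrating the two minorants, the one for x <= -2R after a
  reflection.\<close>

lemma (in real_distribution) unimodal_convolution_centered_normal:
  fixes e t :: real
  defines "\<alpha> \<equiv> LINT y|M. exp (e * y\<^sup>2)"
  assumes "0 < e" and int: "integrable M (\<lambda>y. exp (e * y\<^sup>2))"
    and t_ge: "36 * ln (2 * \<alpha>) / e \<le> t"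
  shows "unimodal (M \<star> centered_normal t)"
proof -
  \<comment> \<open>This choice makes \<alpha> * exp(-e R^2) equal to 1/2, so 1 - exp(e(y^2-R^2))
    has integral exactly 1/2.\<close>
  define R where "R = sqrt (ln (2 * \<alpha>) / e)"
  have "(LINT y|M. 1) \<le> \<alpha>"
    unfolding \<alpha>_def using int \<open>0 < e\<close> by (intro integral_mono) auto
  then have "1 \<le> \<alpha>" using prob_space by simp
  \<comment> \<open>The rational bound for ln 2 becomes e R^2 >= 2/3, hence R > 0 and later e t >=
    36 * 2/3 = 24.\<close>
  then have "2 / 3 \<le> ln (2 * \<alpha>)"
    using ln2_ge_two_thirds ln_mono[of 2 "2 * \<alpha>"] by linarith
  moreover then have R2: "e * R\<^sup>2 = ln (2 * \<alpha>)"
    using \<open>0 < e\<close> by (simp add: R_def)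
  ultimately have eR: "2 / 3 \<le> e * R\<^sup>2" by simp
  have "0 < R" using \<open>2 / 3 \<le> ln (2 * \<alpha>)\<close> \<open>0 < e\<close> by (simp add: R_def)
  then have "0 < R\<^sup>2" by simp
  have t: "36 * R\<^sup>2 \<le> t" using t_ge \<open>0 < e\<close> by (simp flip: R2)
  then have "0 < t" using \<open>0 < R\<^sup>2\<close> by linarith
  have \<alpha>R: "\<alpha> * exp (- (e * R\<^sup>2)) = 1 / 2" using \<open>1 \<le> \<alpha>\<close> by (simp add: R2 exp_minus)

  have split: "exp (e * (y\<^sup>2 - s)) = exp (- (e * s)) * exp (e * y\<^sup>2)" for y s :: real
    by (simp add: right_diff_distrib flip: exp_add)
  have int_exp [simp]: "integrable M (\<lambda>y. exp (e * (y\<^sup>2 - s)))" for s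
    unfolding split using int by simp
  have integral_exp [simp]: "(LINT y|M. exp (e * (y\<^sup>2 - s))) = \<alpha> * exp (- (e * s))" for s
    unfolding split \<alpha>_def by simp

  have prob_UNIV: "prob UNIV = 1" using prob_space by simp
  have integral_minorant: "(LINT y|M. b * (1 - exp (e * (y\<^sup>2 - R\<^sup>2))) - exp (e * (y\<^sup>2 - s)) / d)
      = b / 2 - \<alpha> * exp (- (e * s)) / d" for b s d
    by (simp add: \<alpha>R prob_UNIV)

  define G where "G u = exp (- u\<^sup>2 / (2 * t))" for u
  define G1 where "G1 u = - (u / t * exp (- u\<^sup>2 / (2 * t)))" for u
  define G2 where "G2 u = - ((1 - u\<^sup>2 / t) * exp (- u\<^sup>2 / (2 * t)) / t)" for u
  define g where "g x = (LINT y|M. G (x - y)) / sqrt (2 * pi * t)" for x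
  have meas [measurable]: "G1 \<in> borel_measurable borel" "G2 \<in> borel_measurable borel"
    unfolding G1_def[abs_def] G2_def[abs_def] by measurable
  have intG1: "integrable M (\<lambda>y. (x - y) * exp (- (x - y)\<^sup>2 / (2 * t)))" for x
  proof -
    have "integrable M (\<lambda>y. - t * G1 (x - y))"
      using gaussian_deriv1_bound[OF \<open>0 < t\<close>]
      by (intro integrable_mult_right integrable_const_bound[of _ "(1 + t) / t"]) (auto simp: G1_def)
    then show ?thesis using \<open>0 < t\<close> by (simp add: G1_def)
  qed
  have intG2: "integrable M (\<lambda>y. (1 - (x - y)\<^sup>2 / t) * exp (- (x - y)\<^sup>2 / (2 * t)))" for x
  proof -
    have "integrable M (\<lambda>y. - t * G2 (x - y))"
      using gaussian_deriv2_bound[OF \<open>0 < t\<close>]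
      by (intro integrable_mult_right integrable_const_bound[of _ "1 / t"]) (auto simp: G2_def)
    then show ?thesis using \<open>0 < t\<close> by (simp add: G2_def)
  qed
  have deriv_G: "(G has_field_derivative G1 u) (at u)" for u
    unfolding G_def[abs_def] G1_def by (rule gaussian_deriv1[OF \<open>0 < t\<close>])
  have deriv_G1: "(G1 has_field_derivative G2 u) (at u)" for u
    unfolding G1_def[abs_def] G2_def by (rule gaussian_deriv2[OF \<open>0 < t\<close>])
  have bound_G: "\<bar>G u\<bar> \<le> 1" for u
    using \<open>0 < t\<close> by (simp add: G_def)
  have bound_G1: "\<bar>G1 u\<bar> \<le> (1 + t) / t" for u
    unfolding G1_def by (rule gaussian_deriv1_bound[OF \<open>0 < t\<close>])
  have bound_G2: "\<bar>G2 u\<bar> \<le> 1 / t" for u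
    unfolding G2_def by (rule gaussian_deriv2_bound[OF \<open>0 < t\<close>])
  have g_deriv: "(g has_field_derivative (LINT y|M. G1 (x - y)) / sqrt (2 * pi * t)) (at x)" for x
    unfolding g_def[abs_def]
    by (intro DERIV_cdivide)
      (rule has_field_derivative_integral_translate[OF finite_measure_axioms events_eq_borel
          deriv_G meas(1) bound_G bound_G1])
  have g'_deriv: "((\<lambda>x. (LINT y|M. G1 (x - y)) / sqrt (2 * pi * t)) has_field_derivative
      (LINT y|M. G2 (x - y)) / sqrt (2 * pi * t)) (at x)" for x
    by (intro DERIV_cdivide)
      (rule has_field_derivative_integral_translate[OF finite_measure_axioms events_eq_borel
          deriv_G1 meas(2) bound_G1 bound_G2])

  define m where "m x y = (x - R) * exp (- (x + R)\<^sup>2 / (2 * t)) * (1 - exp (e * (y\<^sup>2 - R\<^sup>2)))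
      - exp (e * (y\<^sup>2 - x\<^sup>2)) / (2 * e * x)" for x y
  have int_m: "integrable M (m x)" for x unfolding m_def by simp
  have outer: "0 \<le> (LINT y|M. m x y)" if x: "2 * R \<le> x" for x
  proof -
    \<comment> \<open>Cancelling x+R leaves x+R <= 2et(x-R). There is ample room: x >= 2R already
      gives x+R <= 3(x-R), while 2et >= 48.\<close>
    have "(x + R)\<^sup>2 / (2 * t) \<le> e * (x\<^sup>2 - R\<^sup>2)"
    proof -
      have "24 \<le> e * t" using mult_left_mono[OF t, of e] eR \<open>0 < e\<close> by linarith
      have "x + R \<le> (x - R) * 48" using x \<open>0 < R\<close> by simp
      also have "\<dots> \<le> (x - R) * (2 * (e * t))"
        using \<open>24 \<le> e * t\<close> x \<open>0 < R\<close> by (intro mult_left_mono) auto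
      finally have "x + R \<le> (x - R) * (2 * (e * t))" .
      then have "(x + R) * (x + R) \<le> (x + R) * ((x - R) * (2 * (e * t)))"
        by (rule mult_left_mono) (use x \<open>0 < R\<close> in linarith)
      also have "\<dots> = e * (x\<^sup>2 - R\<^sup>2) * (2 * t)"
        by (simp add: power2_eq_square algebra_simps)
      finally show ?thesis
        using \<open>0 < t\<close> by (simp add: pos_divide_le_eq power2_eq_square)
    qed
    then have le: "exp (- (e * (x\<^sup>2 - R\<^sup>2))) \<le> exp (- (x + R)\<^sup>2 / (2 * t))" by simp
    have "\<alpha> * exp (- (e * x\<^sup>2)) = \<alpha> * exp (- (e * R\<^sup>2)) * exp (- (e * (x\<^sup>2 - R\<^sup>2)))"
      by (simp add: right_diff_distrib flip: exp_add)
    also have "\<dots> \<le> exp (- (x + R)\<^sup>2 / (2 * t)) / 2"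
      using le unfolding \<alpha>R by simp
    \<comment> \<open>From x >= 2R one gets e x (x-R) >= 2 e R^2 >= 4/3, more than the 1/2
      required.\<close>
    also have "\<dots> \<le> (e * x * (x - R)) * exp (- (x + R)\<^sup>2 / (2 * t))"
    proof -
      have "2 * R * R \<le> x * (x - R)" using x \<open>0 < R\<close> by (intro mult_mono) auto
      then have "e * (2 * R * R) \<le> e * (x * (x - R))" using \<open>0 < e\<close> by (intro mult_left_mono) auto
      then have "1 / 2 \<le> e * x * (x - R)" using eR by (simp add: power2_eq_square)
      from mult_right_mono[OF this, of "exp (- (x + R)\<^sup>2 / (2 * t))"] show ?thesis by simp
    qed
    finally have *: "\<alpha> * exp (- (e * x\<^sup>2)) \<le> (e * x * (x - R)) * exp (- (x + R)\<^sup>2 / (2 * t))" .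
    have divide: "a / (2 * e * x) \<le> b * c / 2" if "a \<le> (e * x * b) * c" for a b c
      using that \<open>0 < e\<close> x \<open>0 < R\<close> by (simp add: field_simps)
    from divide[OF *] have "\<alpha> * exp (- (e * x\<^sup>2)) / (2 * e * x) \<le> (x - R) * exp (- (x + R)\<^sup>2 / (2 * t)) / 2" .
    moreover have "(LINT y|M. m x y) = (x - R) * exp (- (x + R)\<^sup>2 / (2 * t)) / 2
        - \<alpha> * exp (- (e * x\<^sup>2)) / (2 * e * x)"
      unfolding m_def by (rule integral_minorant)
    ultimately show ?thesis by (simp only: diff_ge_0_iff_ge)
  qed
  have right: "0 \<le> (LINT y|M. (x - y) * exp (- (x - y)\<^sup>2 / (2 * t)))" if "2 * R \<le> x" for x
  proof (rule order_trans[OF outer[OF that] integral_mono])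
    have "R \<le> x" using that \<open>0 < R\<close> by linarith
    then show "m x y \<le> (x - y) * exp (- (x - y)\<^sup>2 / (2 * t))" for y
      using \<open>0 < R\<close> \<open>0 < e\<close> \<open>0 < t\<close> unfolding m_def by (intro exp_minorant_outer)
  qed (rule int_m intG1)+
  have left: "0 \<le> (LINT y|M. - ((x - y) * exp (- (x - y)\<^sup>2 / (2 * t))))" if "x \<le> - (2 * R)" for x
  proof -
    \<comment> \<open>\<open>m\<close> is even in its second argument, so the minorant at (-x,-y) is
      the one at (-x,y), and \<open>outer\<close> applies at -x.\<close>
    have *: "2 * R \<le> - x" using that by simp
    show ?thesis
    proof (rule order_trans[OF outer[OF *] integral_mono])
      have "R \<le> - x" using * \<open>0 < R\<close> by linarith
      moreover have "- x - - y = - (x - y)" for y by simp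
      ultimately show "m (- x) y \<le> - ((x - y) * exp (- (x - y)\<^sup>2 / (2 * t)))" for y
        using exp_minorant_outer[OF \<open>0 < R\<close> _ \<open>0 < e\<close> \<open>0 < t\<close>, of "- x" "- y"]
        by (simp only: m_def power2_minus mult_minus_left)
    qed (rule int_m integrable_minus[OF intG1])+
  qed
  have mid: "0 \<le> (LINT y|M. (1 - (x - y)\<^sup>2 / t) * exp (- (x - y)\<^sup>2 / (2 * t)))"
    if "\<bar>x\<bar> \<le> 2 * R" for x
  proof -
    \<comment> \<open>The minorant integrates to 1/2 - 1/4 - \<alpha> * exp(-16 e R^2). The last
      term is exp(-15 e R^2)/2, at most 1/4 because exp(-e R^2) = 1/(2\<alpha>) <= 1/2.\<close>
    have "exp (- (e * R\<^sup>2)) \<le> 1 / 2" using \<open>1 \<le> \<alpha>\<close> by (simp add: R2 exp_minus field_simps)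
    moreover have "exp (- (15 * (e * R\<^sup>2))) \<le> exp (- (e * R\<^sup>2))" using eR by simp
    moreover have "\<alpha> * exp (- (e * (16 * R\<^sup>2))) = \<alpha> * exp (- (e * R\<^sup>2)) * exp (- (15 * (e * R\<^sup>2)))"
      by (simp add: mult.assoc flip: exp_add)
    ultimately have "\<alpha> * exp (- (e * (16 * R\<^sup>2))) \<le> 1 / 4" unfolding \<alpha>R by linarith
    then have "0 \<le> (LINT y|M. 1 / 2 - exp (e * (y\<^sup>2 - R\<^sup>2)) / 2 - exp (e * (y\<^sup>2 - 16 * R\<^sup>2)))"
      by (simp add: \<alpha>R prob_UNIV)
    also have "\<dots> \<le> (LINT y|M. (1 - (x - y)\<^sup>2 / t) * exp (- (x - y)\<^sup>2 / (2 * t)))"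
      by (rule integral_mono[OF _ intG2 exp_minorant_inner[OF \<open>0 < R\<close> that \<open>0 < e\<close> t]]) simp
    finally show ?thesis .
  qed

  have G1_eq: "(LINT y|M. G1 (x - y)) = - (LINT y|M. (x - y) * exp (- (x - y)\<^sup>2 / (2 * t))) / t" for x
    by (simp add: G1_def)
  have G2_eq: "(LINT y|M. G2 (x - y))
      = - (LINT y|M. (1 - (x - y)\<^sup>2 / t) * exp (- (x - y)\<^sup>2 / (2 * t))) / t" for x
    by (simp add: G2_def)
  obtain a where "mono_on {..<a} g" "antimono_on {a<..} g"
  proof (rule mono_antimono_on_if_deriv[OF g_deriv g'_deriv])
    show "0 \<le> (LINT y|M. G1 (x - y)) / sqrt (2 * pi * t)" if "x \<le> - (2 * R)" for x
      unfolding G1_eq using left[OF that] \<open>0 < t\<close>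
      by (intro divide_nonneg_nonneg) simp_all
    show "(LINT y|M. G1 (x - y)) / sqrt (2 * pi * t) \<le> 0" if "2 * R \<le> x" for x
      unfolding G1_eq using right[OF that] \<open>0 < t\<close>
      by (intro divide_nonpos_nonneg) simp_all
    show "(LINT y|M. G2 (x - y)) / sqrt (2 * pi * t) \<le> 0" if "\<bar>x\<bar> \<le> 2 * R" for x
      unfolding G2_eq using mid[OF that] \<open>0 < t\<close>
      by (intro divide_nonpos_nonneg) simp_all
  qed (use \<open>0 < R\<close> in simp)
  moreover have "g \<in> borel_measurable borel"
    by (intro borel_measurable_continuous_onI continuous_at_imp_continuous_on ballI)
      (rule DERIV_isCont[OF g_deriv])
  moreover have "0 \<le> g x" for x
    unfolding g_def G_def using \<open>0 < t\<close>
    by (intro divide_nonneg_nonneg Bochner_Integration.integral_nonneg) simp_all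
  ultimately have "unimodal (density lborel (\<lambda>x. ennreal (g x)))"
    by (intro unimodal_densityI)
  then show ?thesis
    by (simp add: convolution_centered_normal[OF \<open>0 < t\<close>] g_def G_def)
qed


section \<open>A lacunary measure\<close>

text \<open>Recovers measurability of the density supplied by \<open>unimodal\<close>: monotone
  functions are measurable on each half-line, and the value at \<open>a\<close> is
  arbitrary.\<close>

lemma borel_measurable_mono_antimono_on:
  fixes f :: "real \<Rightarrow> real"
  assumes "mono_on {..<a} f" "antimono_on {a<..} f"
  shows "f \<in> borel_measurable borel"
proof (rule measurable_piecewise_restrict[of "{{..<a}, {a}, {a<..}}"])
  have "mono_on {a<..} (\<lambda>x. - f x)"
    using assms(2) by (auto simp: monotone_on_def)
  then have "(\<lambda>x. - (- f x)) \<in> borel_measurable (restrict_space borel {a<..})"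
    by (intro borel_measurable_uminus borel_measurable_mono_on_fnc)
  moreover have "mono_on {a} f" by (simp add: monotone_on_def)
  ultimately show "f \<in> borel_measurable (restrict_space borel S)"
    if "S \<in> {{..<a}, {a}, {a<..}}" for S
    using that assms(1) by (auto intro: borel_measurable_mono_on_fnc)
qed (auto simp: not_less_iff_gr_or_eq)

text \<open>Right of the mode the Dirac part is not seen. Both masses are compared with the constant
  f x, an upper bound for f on [x,x+1] and, since m+1 <= x, a lower bound on [m,m+1].\<close>

lemma unimodal_emeasure_Icc_antimono:
  assumes "unimodal M"
  obtains a where "\<And>m x. a < m \<Longrightarrow> m + 1 \<le> x \<Longrightarrow> emeasure M {x..x+1} \<le> emeasure M {m..m+1}"
proof -
  obtain a f where f: "\<And>x. 0 \<le> f x" "mono_on {..<a} f" "antimono_on {a<..} f"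
    and M: "\<And>B. B \<in> sets borel \<Longrightarrow> emeasure M B =
        emeasure M {a} * emeasure (return borel a) B + emeasure (density lborel (\<lambda>x. ennreal (f x))) B"
    using assms unfolding unimodal_def by blast
  have [measurable]: "f \<in> borel_measurable borel"
    using f(2,3) by (rule borel_measurable_mono_antimono_on)
  have Icc: "emeasure M {z..z+1} = (\<integral>\<^sup>+u. ennreal (f u) * indicator {z..z+1} u \<partial>lborel)" if "a < z" for z
    using that by (subst M) (auto simp: emeasure_density)
  have const: "(\<integral>\<^sup>+u. ennreal c * indicator {z..z+1} u \<partial>lborel) = ennreal c" for c z :: real
    by (simp add: nn_integral_cmult_indicator)
  have anti: "f y \<le> f x" if "a < x" "x \<le> y" for x y
    using f(3) that by (auto simp: monotone_on_def)
  have "emeasure M {x..x+1} \<le> emeasure M {m..m+1}" if "a < m" "m + 1 \<le> x" for m x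
  proof -
    have "emeasure M {x..x+1} \<le> (\<integral>\<^sup>+u. ennreal (f x) * indicator {x..x+1} u \<partial>lborel)"
      using that by (subst Icc) (auto intro!: nn_integral_mono anti ennreal_leI split: split_indicator)
    also have "\<dots> = (\<integral>\<^sup>+u. ennreal (f x) * indicator {m..m+1} u \<partial>lborel)"
      by (simp only: const)
    also have "\<dots> \<le> emeasure M {m..m+1}"
      using that by (subst Icc) (auto intro!: nn_integral_mono anti ennreal_leI split: split_indicator)
    finally show ?thesis .
  qed
  then show thesis by (rule that)
qed

text \<open>The density of a unimodal measure is determined only almost everywhere, so \<open>g\<close> is compared through the masses of
  unit intervals.\<close>
lemma not_unimodal_densityI:
  fixes g :: "real \<Rightarrow> real"
  assumes [measurable]: "g \<in> borel_measurable borel" and nonneg: "\<And>x. 0 \<le> g x"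
    and fin: "finite_measure (density lborel (\<lambda>x. ennreal (g x)))"
    and wit: "\<And>a. \<exists>m x d. a < m \<and> m + 1 \<le> x \<and> 0 < d \<and> (\<forall>s\<in>{0..1}. g (m + s) + d \<le> g (x + s))"
  shows "\<not> unimodal (density lborel (\<lambda>x. ennreal (g x)))" (is "\<not> unimodal ?M")
proof
  assume "unimodal ?M"
  then obtain a where
    a: "\<And>m x. a < m \<Longrightarrow> m + 1 \<le> x \<Longrightarrow> emeasure ?M {x..x+1} \<le> emeasure ?M {m..m+1}"
    using unimodal_emeasure_Icc_antimono by blast
  obtain m x d where mxd: "a < m" "m + 1 \<le> x" "0 < d" "\<forall>s\<in>{0..1}. g (m + s) + d \<le> g (x + s)"
    using wit by blast
  have Icc: "emeasure ?M {z..z+1} = (\<integral>\<^sup>+s. ennreal (g (z + s)) * indicator {0..1} s \<partial>lborel)" for z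
  proof -
    have "emeasure ?M {z..z+1} = (\<integral>\<^sup>+u. ennreal (g u) * indicator {z..z+1} u \<partial>lborel)"
      by (simp add: emeasure_density)
    also have "\<dots> = (\<integral>\<^sup>+s. ennreal (g (z + s)) * indicator {0..1} s \<partial>lborel)"
      by (subst nn_integral_real_affine[of _ 1 z])
        (auto intro!: nn_integral_cong split: split_indicator)
    finally show ?thesis .
  qed
  have "emeasure ?M {m..m+1} + ennreal d
      = (\<integral>\<^sup>+s. (ennreal (g (m + s)) * indicator {0..1} s + ennreal d * indicator {0..1} s) \<partial>lborel)"
    by (simp add: Icc nn_integral_add nn_integral_cmult_indicator)
  also have "\<dots> \<le> emeasure ?M {x..x+1}"
    unfolding Icc using mxd nonneg
    by (intro nn_integral_mono) (auto simp flip: ennreal_plus intro!: ennreal_leI split: split_indicator)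
  also have "\<dots> \<le> emeasure ?M {m..m+1}" using mxd by (intro a)
  finally have "emeasure ?M {m..m+1} + ennreal d \<le> emeasure ?M {m..m+1} + 0" by simp
  \<comment> \<open>Cancellation in \<open>ennreal\<close> requires a finite mass; it leaves d <= 0,
    a contradiction.\<close>
  moreover have "emeasure ?M {m..m+1} \<noteq> \<infinity>"
    using finite_measure.emeasure_finite[OF fin] by simp
  ultimately show False using \<open>0 < d\<close>
    by (metis ennreal_add_left_cancel_le ennreal_eq_0_iff infinity_ennreal_def le_zero_eq not_le)
qed

section \<open>Weights of the lacunary measure\<close>

lemma real_of_nat_le_power:
  fixes b :: real
  assumes "2 \<le> b"
  shows "real n \<le> b ^ n"
proof -
  have "real n \<le> 2 ^ n" using of_nat_less_two_power[of n, where ?'a = real] by linarith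
  also have "\<dots> \<le> b ^ n" using assms by (intro power_mono) auto
  finally show ?thesis .
qed

text \<open>For q < 16 the term 16^n/n eventually exceeds A q^n + n, so the series is dominated by a
  geometric one of ratio exp(-1). The case q = 4^p with p < 2 gives the finite moments.\<close>

lemma summable_exp_lacunary:
  fixes A q :: real
  assumes "0 \<le> A" "0 \<le> q" "q < 16"
  shows "summable (\<lambda>n. exp (A * q ^ n - 16 ^ n / real n))"
proof (rule summable_comparison_test_ev)
  \<comment> \<open>Raising q to at least 4 gives n <= r^n, so that A q^n + n is absorbed into (A+1)
    r^n while r stays below 16.\<close>
  define r where "r = max q 4"
  have r: "q \<le> r" "4 \<le> r" "r < 16" using assms by (auto simp: r_def)
  have "(\<lambda>n. (A + 1) * (real n * (r / 16) ^ n)) \<longlonglongrightarrow> (A + 1) * 0"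
    using r by (intro tendsto_mult_left powser_times_n_limit_0) auto
  then have "\<forall>\<^sub>F n in sequentially. (A + 1) * (real n * (r / 16) ^ n) < 1"
    by (rule order_tendstoD) auto
  then show "\<forall>\<^sub>F n in sequentially. norm (exp (A * q ^ n - 16 ^ n / real n)) \<le> exp (- 1) ^ n"
    using eventually_gt_at_top[of 0]
  proof eventually_elim
    case (elim n)
    have "real n \<le> 4 ^ n" by (rule real_of_nat_le_power) simp
    also have "\<dots> \<le> r ^ n" using r by (intro power_mono) auto
    finally have "A * q ^ n + real n \<le> A * r ^ n + r ^ n"
      using r assms by (intro add_mono mult_left_mono power_mono) auto
    also have "\<dots> = (A + 1) * r ^ n" by (simp add: algebra_simps)
    also have "\<dots> \<le> 16 ^ n / real n"
      using elim by (simp add: power_divide field_simps)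
    finally have "A * q ^ n - 16 ^ n / real n \<le> real n * - 1" by simp
    then have "exp (A * q ^ n - 16 ^ n / real n) \<le> exp (real n * - 1)" by simp
    then show ?case by (simp only: norm_of_real exp_of_nat_mult) simp
  qed
  show "summable (\<lambda>n. exp (- 1 :: real) ^ n)" by (intro summable_geometric) simp
qed

lemma normalized_pmf:
  fixes w :: "nat \<Rightarrow> real"
  assumes "\<And>n. 0 < w n" "summable w"
  obtains p c where "0 < c" "\<And>n. pmf p n = c * w n"
proof -
  define c where "c = 1 / suminf w"
  have "0 < suminf w" using assms by (intro suminf_pos)
  then have "0 < c" by (simp add: c_def)
  have "(\<integral>\<^sup>+n. ennreal (c * w n) \<partial>count_space UNIV) = ennreal (\<Sum>n. c * w n)"
    using assms \<open>0 < c\<close>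
    by (subst nn_integral_count_space_nat, intro suminf_ennreal2) (auto intro: less_imp_le)
  also have "(\<Sum>n. c * w n) = 1"
    using \<open>0 < suminf w\<close> by (subst suminf_mult[OF assms(2)]) (simp add: c_def)
  finally have "pmf (embed_pmf (\<lambda>n. c * w n)) n = c * w n" for n
    using assms \<open>0 < c\<close> by (intro pmf_embed_pmf) (auto intro: less_imp_le)
  with \<open>0 < c\<close> show thesis by (rule that)
qed

section \<open>Failure of unimodality\<close>

text \<open>An atom with k > n is nearer to 4^n+s than to 4^n/2+s. For k <= n the lower point is at
  distance at least 4^n/4 from 4^k, which gives the loss exp(-(4^n/4)^2/(2t)). The atom k = n lies
  within distance 1 of the upper point, which gives the gain.\<close>

lemma gaussian_lacunary_gap:
  fixes t s :: real and n k :: nat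
  assumes "0 < t" "1 \<le> n" "0 \<le> s" "s \<le> 1"
  shows "exp (- 1 / (2 * t)) * indicator {n} k - exp (- (16 ^ n) / (32 * t))
    \<le> exp (- (4 ^ n + s - 4 ^ k)\<^sup>2 / (2 * t)) - exp (- (4 ^ n / 2 + s - 4 ^ k)\<^sup>2 / (2 * t))"
    (is "?c * _ - ?d \<le> ?p - ?q")
proof -
  have x: "(4::real) \<le> 4 ^ n" using power_increasing[of 1 n "4::real"] assms by simp
  have antimono: "exp (- b\<^sup>2 / (2 * t)) \<le> exp (- a\<^sup>2 / (2 * t))" if "\<bar>a\<bar> \<le> \<bar>b\<bar>" for a b
    using that assms by (simp add: divide_right_mono abs_le_square_iff)
  have d: "?d = exp (- (4 ^ n / 4)\<^sup>2 / (2 * t))"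
  proof -
    have "((4::real) ^ n)\<^sup>2 = 16 ^ n" by (simp add: power2_eq_square flip: power_mult_distrib)
    then show ?thesis by (simp add: power_divide)
  qed
  consider "n < k" | "k = n" | "k < n" by linarith
  then show ?thesis
  proof cases
    case 1
    then have "(4::real) ^ Suc n \<le> 4 ^ k" by (intro power_increasing) auto
    then have "?q \<le> ?p" using x assms by (intro antimono) auto
    moreover have "0 < ?d" by simp
    ultimately have "- ?d \<le> ?p - ?q" by linarith
    then show ?thesis using 1 by simp
  next
    case 2
    have "?q \<le> ?d" unfolding d using 2 x assms by (intro antimono) auto
    moreover have "?c \<le> ?p" using antimono[of s 1] 2 assms by simp
    ultimately have "?c - ?d \<le> ?p - ?q" by linarith
    then show ?thesis using 2 by simp
  next
    case 3
    then have "(4::real) ^ Suc k \<le> 4 ^ n" by (intro power_increasing) auto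
    then have "?q \<le> ?d" unfolding d using x assms by (intro antimono) auto
    moreover have "0 < ?p" by simp
    ultimately have "- ?d \<le> ?p - ?q" by linarith
    then show ?thesis using 3 by simp
  qed
qed

text \<open>The exponent 16^n/(32t) is split into two halves: once n >= 64t one half covers 16^n/n,
  and the other tends to infinity and beats the constants.\<close>

lemma eventually_lacunary_weight_dominates:
  fixes c t :: real
  assumes "0 < c" "0 < t"
  shows "\<forall>\<^sub>F n in sequentially.
    exp (- (16 ^ n) / (32 * t)) < exp (- 1 / (2 * t)) * (c * exp (- (16 ^ n / real n)))"
proof -
  have "(\<lambda>n. exp (- (real n / (64 * t)))) \<longlonglongrightarrow> 0"
    using assms by real_asymp
  moreover have "0 < exp (- 1 / (2 * t)) * c" using assms by simp
  ultimately have "\<forall>\<^sub>F n in sequentially. exp (- (real n / (64 * t))) < exp (- 1 / (2 * t)) * c"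
    by (rule order_tendstoD)
  then show ?thesis
    using eventually_gt_at_top[of 0] eventually_ge_at_top[of "nat \<lceil>64 * t\<rceil>"]
  proof eventually_elim
    case (elim n)
    have "real n \<le> 16 ^ n" by (rule real_of_nat_le_power) simp
    have "64 * t \<le> real n" using elim(3) by linarith
    then have "16 ^ n / real n \<le> 16 ^ n / (64 * t)" using assms by (intro divide_left_mono) auto
    have "exp (- (16 ^ n) / (32 * t)) = exp (- (16 ^ n / (64 * t))) * exp (- (16 ^ n / (64 * t)))"
      by (simp flip: exp_add)
    also have "\<dots> \<le> exp (- (real n / (64 * t))) * exp (- (16 ^ n / real n))"
      using \<open>real n \<le> 16 ^ n\<close> \<open>16 ^ n / real n \<le> _\<close> assms
      by (intro mult_mono) (auto simp: divide_right_mono)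
    also have "\<dots> < exp (- 1 / (2 * t)) * c * exp (- (16 ^ n / real n))"
      using elim by simp
    finally show ?case by (simp add: mult.assoc)
  qed
qed

text \<open>For \<open>n = 0\<close> the exponent \<open>16\<^sup>n/n\<close> is \<open>1/0 = 0\<close>, which is harmless.\<close>
lemma lacunary_counterexample:
  fixes p :: "nat pmf" and c :: real
  defines "\<mu> \<equiv> distr (measure_pmf p) borel (\<lambda>n. 4 ^ n :: real)"
  assumes c: "0 < c" and p: "\<And>n. pmf p n = c * exp (- (16 ^ n / real n))"
  shows "real_distribution \<mu>"
    and "\<And>A q. 0 < A \<Longrightarrow> q < 2 \<Longrightarrow> (\<integral>\<^sup>+ x. ennreal (exp (A * \<bar>x\<bar> powr q)) \<partial>\<mu>) < \<infinity>"
    and "\<And>A. 0 < A \<Longrightarrow> (\<integral>\<^sup>+ x. ennreal (exp (A * x\<^sup>2)) \<partial>\<mu>) = \<infinity>"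
    and "\<And>t. 0 < t \<Longrightarrow> \<not> unimodal (\<mu> \<star> centered_normal t)"
proof -
  show \<mu>: "real_distribution \<mu>"
    unfolding \<mu>_def by (intro prob_space.real_distribution_distr prob_space_measure_pmf) simp
  then interpret real_distribution \<mu> .
  have nn: "(\<integral>\<^sup>+x. ennreal (f x) \<partial>\<mu>)
      = (\<integral>\<^sup>+n. ennreal (c * exp (- (16 ^ n / real n)) * f (4 ^ n)) \<partial>count_space UNIV)"
    if "f \<in> borel_measurable borel" for f :: "real \<Rightarrow> real"
    unfolding \<mu>_def using that c
    by (subst nn_integral_distr) (auto simp: nn_integral_measure_pmf p ennreal_mult')

  show "(\<integral>\<^sup>+ x. ennreal (exp (A * \<bar>x\<bar> powr q)) \<partial>\<mu>) < \<infinity>" if "0 < A" "q < 2" for A q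
  proof -
    \<comment> \<open>Here q < 2 becomes the condition 4^q < 16 of
      \<open>summable_exp_lacunary\<close>.\<close>
    have "4 powr q < 4 powr 2" using that by (intro powr_less_mono) auto
    then have "4 powr q < 16" by (simp add: powr_numeral)
    then have "summable (\<lambda>n. c * exp (A * (4 powr q) ^ n - 16 ^ n / real n))"
      using that by (intro summable_mult summable_exp_lacunary) auto
    then have sum: "(\<Sum>n. ennreal (c * exp (A * (4 powr q) ^ n - 16 ^ n / real n))) < \<infinity>"
      using c by (subst suminf_ennreal2) simp_all
    have eq: "c * exp (- (16 ^ n / real n)) * exp (A * \<bar>4 ^ n\<bar> powr q)
        = c * exp (A * (4 powr q) ^ n - 16 ^ n / real n)" for n
    proof -
      have "\<bar>4 ^ n\<bar> powr q = (4 powr q) ^ n"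
        by (simp add: powr_powr mult.commute flip: powr_realpow)
      then show ?thesis by (simp flip: exp_add)
    qed
    have "(\<lambda>x. exp (A * \<bar>x\<bar> powr q)) \<in> borel_measurable borel" by measurable
    from nn[OF this] show ?thesis
      using sum by (simp only: nn_integral_count_space_nat eq)
  qed

  show "(\<integral>\<^sup>+ x. ennreal (exp (A * x\<^sup>2)) \<partial>\<mu>) = \<infinity>" if "0 < A" for A
  proof (rule ccontr)
    assume "\<not> ?thesis"
    then obtain B where "0 \<le> B" and B: "(\<integral>\<^sup>+ x. ennreal (exp (A * x\<^sup>2)) \<partial>\<mu>) = ennreal B"
      by (cases "\<integral>\<^sup>+ x. ennreal (exp (A * x\<^sup>2)) \<partial>\<mu>") auto
    \<comment> \<open>The contribution of a single atom is bounded by the whole integral.\<close>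
    have le: "c * exp (- (16 ^ n / real n)) * exp (A * (4 ^ n)\<^sup>2) \<le> B" for n
    proof -
      have "ennreal (c * exp (- (16 ^ n / real n)) * exp (A * (4 ^ n)\<^sup>2)) \<le> ennreal B"
        unfolding B[symmetric] by (subst nn) (auto intro: nn_integral_ge_point)
      then show ?thesis using \<open>0 \<le> B\<close> by (simp add: ennreal_le_iff)
    qed
    \<comment> \<open>The first bound gives 1/n <= A/2, so the coefficient A - 1/n of 16^n is at
      least A/2; the second makes c(A/2)n exceed B.\<close>
    obtain n :: nat where n: "real n > max (2 / A) (2 * B / (c * A))"
      using reals_Archimedean2 by blast
    then have "0 < real n" using \<open>0 < A\<close> by (smt (verit) divide_pos_pos)
    have "real n \<le> 16 ^ n" by (rule real_of_nat_le_power) simp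
    have "1 / real n \<le> A / 2" using n \<open>0 < A\<close> \<open>0 < real n\<close> by (simp add: field_simps)
    have "B < c * (A / 2 * real n)" using n c \<open>0 < A\<close> by (simp add: field_simps)
    also have "\<dots> \<le> c * exp (A / 2 * real n)"
      using c exp_ge_add_one_self[of "A / 2 * real n"] by (intro mult_left_mono) linarith+
    also have "\<dots> \<le> c * exp ((A - 1 / real n) * 16 ^ n)"
    proof -
      have "A / 2 * real n \<le> (A - 1 / real n) * 16 ^ n"
        using \<open>1 / real n \<le> A / 2\<close> \<open>real n \<le> 16 ^ n\<close> \<open>0 < A\<close> by (intro mult_mono) linarith+
      then show ?thesis using c by simp
    qed
    also have "\<dots> = c * exp (- (16 ^ n / real n)) * exp (A * (4 ^ n)\<^sup>2)"
    proof -
      have "((4::real) ^ n)\<^sup>2 = 16 ^ n" by (simp add: power2_eq_square flip: power_mult_distrib)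
      then show ?thesis by (simp add: left_diff_distrib flip: exp_add)
    qed
    finally show False using le[of n] by simp
  qed

  show "\<not> unimodal (\<mu> \<star> centered_normal t)" if t: "0 < t" for t
  proof -
    define N where "N = sqrt (2 * pi * t)"
    define g where "g x = (LINT y|\<mu>. exp (- (x - y)\<^sup>2 / (2 * t))) / N" for x
    have "0 < N" using t by (simp add: N_def)
    have conv: "\<mu> \<star> centered_normal t = density lborel (\<lambda>x. ennreal (g x))"
      using convolution_centered_normal[OF t] by (simp add: g_def N_def)
    have "\<not> unimodal (density lborel (\<lambda>x. ennreal (g x)))"
    proof (rule not_unimodal_densityI)
      show "g \<in> borel_measurable borel" unfolding g_def[abs_def] by measurable
      show "0 \<le> g x" for x
        unfolding g_def using \<open>0 < N\<close>
        by (intro divide_nonneg_nonneg Bochner_Integration.integral_nonneg) simp_all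
      have "finite_measure (centered_normal t)"
        using t prob_space_normal_density[of "sqrt t" 0]
        unfolding centered_normal_def by (auto intro: prob_space.finite_measure)
      then show "finite_measure (density lborel (\<lambda>x. ennreal (g x)))"
        unfolding conv[symmetric]
        by (intro convolution_finite finite_measure_axioms) (auto simp: centered_normal_def)
      fix a :: real
      have "\<forall>\<^sub>F n in sequentially. a < 4 ^ n / 2" by real_asymp
      then have "\<forall>\<^sub>F n in sequentially. 1 \<le> n \<and> a < 4 ^ n / 2 \<and>
          exp (- (16 ^ n) / (32 * t)) < exp (- 1 / (2 * t)) * (c * exp (- (16 ^ n / real n)))"
        using eventually_ge_at_top[of 1] eventually_lacunary_weight_dominates[OF c t]
        by eventually_elim simp
      then obtain n :: nat where n: "1 \<le> n" "a < 4 ^ n / 2"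
        "exp (- (16 ^ n) / (32 * t)) < exp (- 1 / (2 * t)) * (c * exp (- (16 ^ n / real n)))"
        unfolding eventually_sequentially by blast
      \<comment> \<open>\<open>d\<close> is the mean under \<open>p\<close> of the lower bound in
        \<open>gaussian_lacunary_gap\<close>: the indicator has mean \<open>pmf p n\<close>, and the
        subtracted term does not depend on k. It is positive by the choice of n.\<close>
      define d where "d = exp (- 1 / (2 * t)) * (c * exp (- (16 ^ n / real n))) - exp (- (16 ^ n) / (32 * t))"
      have "g (4 ^ n / 2 + s) + d / N \<le> g (4 ^ n + s)" if "s \<in> {0..1}" for s
      proof -
        have int: "integrable p (\<lambda>k. exp (- (z - 4 ^ k)\<^sup>2 / (2 * t)))" for z :: real
          using t by (intro measure_pmf.integrable_const_bound[of _ 1]) auto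
        have eq: "(LINT y|\<mu>. exp (- (z - y)\<^sup>2 / (2 * t))) = (LINT k|p. exp (- (z - 4 ^ k)\<^sup>2 / (2 * t)))" for z
          unfolding \<mu>_def by (subst integral_distr) auto
        have intn: "integrable p (\<lambda>k. indicator {n} k :: real)"
          by (intro measure_pmf.integrable_const_bound[of _ 1]) auto
        have "d = (LINT k|p. exp (- 1 / (2 * t)) * indicator {n} k - exp (- (16 ^ n) / (32 * t)))"
          using intn by (simp add: d_def measure_pmf_single p)
        also have "\<dots> \<le> (LINT k|p. exp (- (4 ^ n + s - 4 ^ k)\<^sup>2 / (2 * t)) - exp (- (4 ^ n / 2 + s - 4 ^ k)\<^sup>2 / (2 * t)))"
        proof (rule integral_mono)
          show "exp (- 1 / (2 * t)) * indicator {n} k - exp (- (16 ^ n) / (32 * t))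
            \<le> exp (- (4 ^ n + s - 4 ^ k)\<^sup>2 / (2 * t)) - exp (- (4 ^ n / 2 + s - 4 ^ k)\<^sup>2 / (2 * t))" for k
            using that n(1) t by (intro gaussian_lacunary_gap) auto
        qed (use intn in simp, rule Bochner_Integration.integrable_diff[OF int int])
        also have "\<dots> = N * g (4 ^ n + s) - N * g (4 ^ n / 2 + s)"
          unfolding g_def eq using int \<open>0 < N\<close> by simp
        finally show ?thesis using \<open>0 < N\<close> by (simp add: field_simps)
      qed
      moreover have "0 < d / N" using n(3) \<open>0 < N\<close> by (simp add: d_def)
      moreover have "4 ^ n / 2 + 1 \<le> (4 ^ n :: real)"
        using power_increasing[of 1 n "4::real"] n(1) by simp
      ultimately show "\<exists>m x d. a < m \<and> m + 1 \<le> x \<and> 0 < d \<and> (\<forall>s\<in>{0..1}. g (m + s) + d \<le> g (x + s))"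
        using n(2) by blast
    qed
    then show ?thesis by (simp add: conv)
  qed
qed

theorem theorem1p3:
  shows "(\<forall>(\<mu> :: real measure) (\<epsilon> :: real) (\<alpha> :: ennreal) (t :: real).
            real_distribution \<mu> \<longrightarrow> \<epsilon> > 0 \<longrightarrow>
            \<alpha> = (\<integral>\<^sup>+ x. ennreal (exp (\<epsilon> * x\<^sup>2)) \<partial>\<mu>) \<longrightarrow> \<alpha> < \<infinity> \<longrightarrow>
            t \<ge> 36 * ln (2 * enn2real \<alpha>) / \<epsilon> \<longrightarrow>
            unimodal (\<mu> \<star> centered_normal t))
       \<and> (\<exists>\<mu> :: real measure. real_distribution \<mu> \<and>
            (\<forall>A>0::real. \<forall>p::real. 0 < p \<longrightarrow> p < 2 \<longrightarrow>
               (\<integral>\<^sup>+ x. ennreal (exp (A * \<bar>x\<bar> powr p)) \<partial>\<mu>) < \<infinity>) \<and>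
            (\<forall>A>0::real. (\<integral>\<^sup>+ x. ennreal (exp (A * x\<^sup>2)) \<partial>\<mu>) = \<infinity>) \<and>
            (\<forall>t>0::real. \<not> unimodal (\<mu> \<star> centered_normal t)))"
proof (intro conjI allI impI)
  fix \<mu> :: "real measure" and \<epsilon> t :: real and \<alpha> :: ennreal
  assume "real_distribution \<mu>" and "0 < \<epsilon>"
    and \<alpha>: "\<alpha> = (\<integral>\<^sup>+ x. ennreal (exp (\<epsilon> * x\<^sup>2)) \<partial>\<mu>)" "\<alpha> < \<infinity>"
    and t: "t \<ge> 36 * ln (2 * enn2real \<alpha>) / \<epsilon>"
  interpret real_distribution \<mu> by fact
  have int: "integrable \<mu> (\<lambda>x. exp (\<epsilon> * x\<^sup>2))"
    using \<alpha> by (intro integrableI_nonneg) auto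
  have "enn2real \<alpha> = (LINT x|\<mu>. exp (\<epsilon> * x\<^sup>2))"
    unfolding \<alpha>(1) by (intro integral_eq_nn_integral[symmetric]) auto
  with t show "unimodal (\<mu> \<star> centered_normal t)"
    by (intro unimodal_convolution_centered_normal[OF \<open>0 < \<epsilon>\<close> int]) (simp only:)
next
  \<comment> \<open>Taking A = q = 0 leaves the bare weights, which can therefore be
    normalised.\<close>
  have "summable (\<lambda>n. exp (0 * 0 ^ n - 16 ^ n / real n))"
    by (rule summable_exp_lacunary) auto
  then have "summable (\<lambda>n. exp (- (16 ^ n / real n)))" by simp
  then obtain p c where "0 < c" "\<And>n. pmf p n = c * exp (- (16 ^ n / real n))"
    using normalized_pmf[of "\<lambda>n. exp (- (16 ^ n / real n))", OF exp_gt_zero] by metis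
  note lacunary = lacunary_counterexample[OF this]
  then show "\<exists>\<mu> :: real measure. real_distribution \<mu> \<and>
      (\<forall>A>0::real. \<forall>p::real. 0 < p \<longrightarrow> p < 2 \<longrightarrow>
         (\<integral>\<^sup>+ x. ennreal (exp (A * \<bar>x\<bar> powr p)) \<partial>\<mu>) < \<infinity>) \<and>
      (\<forall>A>0::real. (\<integral>\<^sup>+ x. ennreal (exp (A * x\<^sup>2)) \<partial>\<mu>) = \<infinity>) \<and>
      (\<forall>t>0::real. \<not> unimodal (\<mu> \<star> centered_normal t))"
    by blast
qed

end
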